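(* Let $X$ be an $n\times p$ real matrix, $Y=X\beta^0+\epsilon$, $\sigma>0$, $\bar\lambda>0$, $\underline\lambda>0$. Let $\hat\beta(\sigma)$ be the Lasso, $\hat\Theta_\sharp$ the square-root node-wise Lasso surrogate inverse with associated $\hat\tau_{j,\sharp}$, $\tilde\tau_{j,\sharp}^2$, and $\hat b_\sharp(\sigma)$ the de-sparsified Lasso, all as defined in the context. Then for all $j\in\{1,\dots,p\}$ there exists a vector $v_j\in\mathbb{R}^n$ with $\|v_j\|_n=1$, depending on $X$ and $\underline\lambda$ only (not on $\epsilon$), such that $$\frac{\tilde\tau_{j,\sharp}^2}{\hat\tau_{j,\sharp}}\big(\hat b_{j,\sharp}(\sigma)-\beta_j^0\big)=v_j^T\epsilon/n+\mathrm{rem}_j(\sigma),$$ where the remainder $\mathrm{rem}(\sigma)=(\mathrm{rem}_1(\sigma),\dots,\mathrm{rem}_p(\sigma))^T$ satisfies $$\|\mathrm{rem}(\sigma)\|_\infty\le\underline\lambda\,\|\hat\beta(\sigma)-\beta^0\|_1 .$$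
   Context: $X$ has rank $n$, $f^0=\mathbb{E}(Y|X)$, $\epsilon=Y-f^0$, and $\beta^0\in\mathbb{R}^p$ is any solution of $f^0=X\beta^0$. For $v\in\mathbb{R}^n$, $\|v\|_n:=\sqrt{v^Tv/n}$. $\hat\beta(\sigma)$ is a minimizer over $\beta\in\mathbb{R}^p$ of $\|Y-X\beta\|_n^2+\bar\lambda\sigma\|\beta\|_1$. $X_j$ is the $j$-th column of $X$ and $X_{-j}$ the $n\times(p-1)$ matrix of the other columns. For $\tau_j>0$, $\hat\gamma_j(\tau_j)$ is a (chosen) minimizer over $\gamma_j\in\mathbb{R}^{p-1}$ of $\|X_j-X_{-j}\gamma_j\|_n^2+2\underline\lambda\tau_j\|\gamma_j\|_1$. For the square-root node-wise Lasso, for each $j$ the scale $\hat\tau_{j,\sharp}>0$ is a stable point: $\hat\tau_{j,\sharp}^2=\|X_j-X_{-j}\hat\gamma_j(\hat\tau_{j,\sharp})\|_n^2\ne0$ (such scales are assumed to exist). With $\hat\gamma_j:=\hat\gamma_j(\hat\tau_{j,\sharp})$ having entries $\hat\gamma_{k,j}$, $k\neq j$, put $\tilde\tau_{j,\sharp}^2:=\hat\tau_{j,\sharp}^2+\underline\lambda\hat\tau_{j,\sharp}\|\hat\gamma_j\|_1$. $\hat\Theta_\sharp$ is the $p\times p$ matrix with $(j,j)$ entry $1/\tilde\tau_{j,\sharp}^2$ and $(k,j)$ entry $-\hat\gamma_{k,j}/\tilde\tau_{j,\sharp}^2$ for $k\ne j$. The de-sparsified Lasso is $$\hat b_\sharp(\sigma):=\hat\beta(\sigma)+\hat\Theta_\sharp^TX^T(Y-X\hat\beta(\sigma))/n,$$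 with $j$-th entry $\hat b_{j,\sharp}(\sigma)$. *)

theory Defs
  imports "HOL-Analysis.Analysis"
begin

definition l1_norm :: "real ^ 'k \<Rightarrow> real" where
  "l1_norm b = (\<Sum>k\<in>UNIV. \<bar>b $ k\<bar>)"

definition norm_n :: "real ^ 'n \<Rightarrow> real" where
  "norm_n v = sqrt (v \<bullet> v / real CARD('n))"

definition is_lasso ::
  "real ^ 'p ^ 'n \<Rightarrow> real ^ 'n \<Rightarrow> real \<Rightarrow> real \<Rightarrow> real ^ 'p \<Rightarrow> bool" where
  "is_lasso X Y lam \<sigma> \<beta>h \<longleftrightarrow>
     is_arg_min (\<lambda>\<beta>. (norm_n (Y - X *v \<beta>))\<^sup>2 + lam * \<sigma> * l1_norm \<beta>) (\<lambda>_. True) \<beta>h"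

text \<open>
  The coefficient space \<open>\<real>\<^sup>p\<^sup>-\<^sup>1\<close> of the regression of column \<open>j\<close> on the other columns, with
  coordinates indexed by \<open>k \<noteq> j\<close>, is identified with the vectors \<open>\<gamma> \<in> \<real>\<^sup>p\<close> such that \<open>\<gamma> $ j = 0\<close>;
  the \<open>l1\<close> norms agree under this identification. The next definition is the residual
  \<open>X\<^sub>j - X\<^sub>-\<^sub>j \<gamma>\<close>.
\<close>

definition nodewise_residual :: "real ^ 'p ^ 'n \<Rightarrow> 'p \<Rightarrow> real ^ 'p \<Rightarrow> real ^ 'n" where
  "nodewise_residual X j \<gamma> = column j X - (\<Sum>k\<in>UNIV - {j}. \<gamma> $ k *\<^sub>R column k X)"

definition is_nodewise_lasso ::
  "real ^ 'p ^ 'n \<Rightarrow> real \<Rightarrow> 'p \<Rightarrow> real \<Rightarrow> real ^ 'p \<Rightarrow> bool" where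
  "is_nodewise_lasso X lam j \<tau> \<gamma>h \<longleftrightarrow>
     is_arg_min (\<lambda>\<gamma>. (norm_n (nodewise_residual X j \<gamma>))\<^sup>2 + 2 * lam * \<tau> * l1_norm \<gamma>)
       (\<lambda>\<gamma>. \<gamma> $ j = 0) \<gamma>h"

text \<open>
  A selection \<open>\<gamma>h j \<tau>\<close> of node-wise Lasso solutions together with stable points \<open>\<tau>h j\<close>.
\<close>

definition is_sqrt_nodewise_lasso ::
  "real ^ 'p ^ 'n \<Rightarrow> real \<Rightarrow> ('p \<Rightarrow> real \<Rightarrow> real ^ 'p) \<Rightarrow> ('p \<Rightarrow> real) \<Rightarrow> bool" where
  "is_sqrt_nodewise_lasso X lam \<gamma>h \<tau>h \<longleftrightarrow>
     (\<forall>j. \<forall>\<tau>>0. is_nodewise_lasso X lam j \<tau> (\<gamma>h j \<tau>)) \<and>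
     (\<forall>j. \<tau>h j > 0 \<and>
          (\<tau>h j)\<^sup>2 = (norm_n (nodewise_residual X j (\<gamma>h j (\<tau>h j))))\<^sup>2 \<and>
          (norm_n (nodewise_residual X j (\<gamma>h j (\<tau>h j))))\<^sup>2 \<noteq> 0)"

text \<open>The squared scale \<open>\<tau>\<^sup>2 + \<lambda> \<tau> \<parallel>\<gamma>\<parallel>\<^sub>1\<close>, not its square root.\<close>

definition tilde_tau_sq ::
  "real \<Rightarrow> ('p \<Rightarrow> real \<Rightarrow> real ^ 'p) \<Rightarrow> ('p \<Rightarrow> real) \<Rightarrow> 'p \<Rightarrow> real" where
  "tilde_tau_sq lam \<gamma>h \<tau>h j = (\<tau>h j)\<^sup>2 + lam * \<tau>h j * l1_norm (\<gamma>h j (\<tau>h j))"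

definition Theta_hat ::
  "real \<Rightarrow> ('p \<Rightarrow> real \<Rightarrow> real ^ 'p) \<Rightarrow> ('p \<Rightarrow> real) \<Rightarrow> real ^ 'p ^ 'p" where
  "Theta_hat lam \<gamma>h \<tau>h =
     (\<chi> k j. if k = j then 1 / tilde_tau_sq lam \<gamma>h \<tau>h j
             else - (\<gamma>h j (\<tau>h j) $ k) / tilde_tau_sq lam \<gamma>h \<tau>h j)"

definition desparsified ::
  "real ^ 'p ^ 'n \<Rightarrow> real ^ 'n \<Rightarrow> real ^ 'p ^ 'p \<Rightarrow> real ^ 'p \<Rightarrow> real ^ 'p" where
  "desparsified X Y \<Theta> \<beta>h =
     \<beta>h + (1 / real CARD('n)) *\<^sub>R (transpose \<Theta> *v (transpose X *v (Y - X *v \<beta>h)))"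

end

theory Submission
  imports Defs
begin

text \<open>
  Take \<open>v\<^sub>j\<close> to be the residual of the \<open>j\<close>-th square-root node-wise Lasso divided by its scale. The
  KKT conditions give \<open>|X\<^sub>k\<^sup>T v\<^sub>j| / n \<le> \<lambda>\<close> for \<open>k \<noteq> j\<close> and \<open>X\<^sub>j\<^sup>T v\<^sub>j / n\<close> equal to the normalising
  factor of the estimator, so the \<open>j\<close>-th term cancels from the bias and the rest is the remainder.
  That \<open>v\<^sub>j\<close> does not depend on the selected minimizer or stable point is the uniqueness of the
  dual solution: pairing one normalised residual with another residual forces equality in
  the Cauchy-Schwarz inequality.
\<close>

section \<open>Elementary facts on the norms and a limit argument\<close>

lemma norm_n_sq:
  fixes v :: "real ^ 'n"
  shows "(norm_n v)\<^sup>2 = v \<bullet> v / real CARD('n)"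
  by (simp add: norm_n_def)

lemma l1_norm_triangle: "l1_norm (a + b) \<le> l1_norm a + l1_norm b"
  unfolding l1_norm_def sum.distrib[symmetric]
  by (rule sum_mono) (simp add: abs_triangle_ineq)

lemma l1_norm_scaleR: "l1_norm (c *\<^sub>R a) = \<bar>c\<bar> * l1_norm a"
  unfolding l1_norm_def sum_distrib_left by (simp add: abs_mult)

lemma l1_norm_uminus [simp]: "l1_norm (- a) = l1_norm a"
  unfolding l1_norm_def by simp

lemma l1_norm_zero [simp]: "l1_norm 0 = 0"
  unfolding l1_norm_def by simp

lemma infnorm_le_iff_component:
  fixes x :: "real ^ 'k"
  shows "infnorm x \<le> c \<longleftrightarrow> (\<forall>i. \<bar>x $ i\<bar> \<le> c)"
  by (auto simp: infnorm_Max Basis_vec_def inner_axis)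

text \<open>Replaces a one-sided derivative: as t tends to 0, the second-order term of a quadratic
  expansion disappears and the sign of the first-order term remains.\<close>

lemma nonpos_if_le_small_multiples:
  fixes a b :: real
  assumes "\<And>t. 0 < t \<Longrightarrow> t < 1 \<Longrightarrow> a \<le> t * b"
  shows "a \<le> 0"
proof (rule tendsto_lowerbound)
  show "((\<lambda>t. t * b) \<longlongrightarrow> 0) (at_right 0)"
    by (auto intro!: tendsto_eq_intros)
  show "\<forall>\<^sub>F t in at_right 0. a \<le> t * b"
    unfolding eventually_at_right_field using assms by (intro exI[of _ 1]) auto
qed simp

lemma matrix_vector_mult_uminus:
  fixes A :: "real ^ 'k ^ 'm"
  shows "A *v (- x) = - (A *v x)"
  using matrix_vector_mult_diff_distrib[of A 0 x] by simp

section \<open>First-order conditions for the node-wise Lasso\<close>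

lemma nodewise_residual_eq:
  assumes "\<gamma> $ j = 0"
  shows "nodewise_residual X j \<gamma> = column j X - X *v \<gamma>"
proof -
  have "X *v \<gamma> = (\<Sum>k\<in>UNIV. \<gamma> $ k *\<^sub>R column k X)"
    by (simp add: matrix_mult_sum scalar_mult_eq_scaleR)
  also have "\<dots> = (\<Sum>k\<in>UNIV - {j}. \<gamma> $ k *\<^sub>R column k X)"
    using assms by (simp add: sum.remove[of UNIV j])
  finally show ?thesis
    by (simp add: nodewise_residual_def)
qed

text \<open>First-order optimality without subgradients: on the segment from \<open>\<gamma>\<close>
  to \<open>\<gamma>'\<close> the square is expanded exactly and the l1 norm is bounded by
  convexity. The factor 2 in the penalty cancels against the one from the cross term of the
  square.\<close>

lemma nodewise_lasso_variational:
  fixes X :: "real ^ 'p ^ 'n"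
  assumes lasso: "is_nodewise_lasso X lam j \<tau> \<gamma>" and "lam * \<tau> \<ge> 0" and \<gamma>': "\<gamma>' $ j = 0"
  shows "nodewise_residual X j \<gamma> \<bullet> (X *v (\<gamma>' - \<gamma>)) / real CARD('n)
           \<le> lam * \<tau> * (l1_norm \<gamma>' - l1_norm \<gamma>)"
proof -
  define r where "r = nodewise_residual X j \<gamma>"
  define d where "d = X *v (\<gamma>' - \<gamma>)"
  define N where "N = real CARD('n)"
  have N: "N > 0"
    by (simp add: N_def)
  have \<gamma>: "\<gamma> $ j = 0"
    using lasso by (simp add: is_nodewise_lasso_def is_arg_min_def)
  \<comment> \<open>Minimality against the point at parameter t of the segment, after division by t.
    Only the right-hand side still depends on t.\<close>
  have "2 * (r \<bullet> d / N - lam * \<tau> * (l1_norm \<gamma>' - l1_norm \<gamma>)) \<le> t * (d \<bullet> d / N)"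
    if t: "0 < t" "t < 1" for t
  proof -
    define g where "g = \<gamma> + t *\<^sub>R (\<gamma>' - \<gamma>)"
    have g: "g $ j = 0"
      using \<gamma> \<gamma>' by (simp add: g_def)
    have res: "nodewise_residual X j g = r - t *\<^sub>R d"
      unfolding r_def d_def nodewise_residual_eq[OF \<gamma>] nodewise_residual_eq[OF g]
      by (simp add: g_def matrix_vector_right_distrib matrix_vector_mult_scaleR)
    have "g = (1 - t) *\<^sub>R \<gamma> + t *\<^sub>R \<gamma>'"
      by (simp add: g_def algebra_simps)
    then have "l1_norm g \<le> (1 - t) * l1_norm \<gamma> + t * l1_norm \<gamma>'"
      using l1_norm_triangle[of "(1 - t) *\<^sub>R \<gamma>" "t *\<^sub>R \<gamma>'"] t by (simp add: l1_norm_scaleR)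
    then have "lam * \<tau> * l1_norm g \<le> lam * \<tau> * ((1 - t) * l1_norm \<gamma> + t * l1_norm \<gamma>')"
      using assms(2) by (rule mult_left_mono)
    moreover have "r \<bullet> r / N + 2 * lam * \<tau> * l1_norm \<gamma>
        \<le> (r - t *\<^sub>R d) \<bullet> (r - t *\<^sub>R d) / N + 2 * lam * \<tau> * l1_norm g"
      using lasso g
      by (auto simp: is_nodewise_lasso_def is_arg_min_linorder norm_n_sq res N_def simp flip: r_def)
    moreover have "(r - t *\<^sub>R d) \<bullet> (r - t *\<^sub>R d) / N
        = r \<bullet> r / N - 2 * t * (r \<bullet> d / N) + t * t * (d \<bullet> d / N)"
      using N by (simp add: inner_diff_left inner_diff_right inner_commute[of d r] field_simps)
    ultimately have
      "t * (2 * (r \<bullet> d / N - lam * \<tau> * (l1_norm \<gamma>' - l1_norm \<gamma>))) \<le> t * (t * (d \<bullet> d / N))"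
      by (simp add: algebra_simps)
    then show ?thesis
      using t(1) by (rule mult_left_le_imp_le)
  qed
  then have "2 * (r \<bullet> d / N - lam * \<tau> * (l1_norm \<gamma>' - l1_norm \<gamma>)) \<le> 0"
    by (rule nonpos_if_le_small_multiples)
  then show ?thesis
    by (simp add: r_def d_def N_def)
qed

text \<open>Dual feasibility: the variational inequality is tested at
  \<open>\<gamma> + \<delta>\<close> and \<open>\<gamma> - \<delta>\<close>, and the triangle
  inequality removes \<open>\<gamma>\<close> from the right-hand side. For \<open>\<delta>\<close>
  the unit vector of some k other than j, this is the usual bound on the correlation of column k
  with the residual.\<close>

lemma nodewise_lasso_score_bound:
  fixes X :: "real ^ 'p ^ 'n"
  assumes lasso: "is_nodewise_lasso X lam j \<tau> \<gamma>" and nn: "lam * \<tau> \<ge> 0" and "\<delta> $ j = 0"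
  shows "\<bar>nodewise_residual X j \<gamma> \<bullet> (X *v \<delta>) / real CARD('n)\<bar> \<le> lam * \<tau> * l1_norm \<delta>"
proof -
  have \<gamma>: "\<gamma> $ j = 0"
    using lasso by (simp add: is_nodewise_lasso_def is_arg_min_def)
  have bound: "nodewise_residual X j \<gamma> \<bullet> (X *v \<eta>) / real CARD('n) \<le> lam * \<tau> * l1_norm \<eta>"
    if "\<eta> $ j = 0" for \<eta>
  proof -
    have "nodewise_residual X j \<gamma> \<bullet> (X *v \<eta>) / real CARD('n)
        \<le> lam * \<tau> * (l1_norm (\<gamma> + \<eta>) - l1_norm \<gamma>)"
      using nodewise_lasso_variational[OF lasso nn, of "\<gamma> + \<eta>"] \<gamma> that by simp
    also have "\<dots> \<le> lam * \<tau> * l1_norm \<eta>"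
      using l1_norm_triangle[of \<gamma> \<eta>] nn by (intro mult_left_mono) auto
    finally show ?thesis .
  qed
  show ?thesis
    using bound[of \<delta>] bound[of "- \<delta>"] assms(3)
    by (simp add: abs_le_iff matrix_vector_mult_uminus)
qed

text \<open>Complementary slackness: dual feasibility gives one inequality, and comparison of
  \<open>\<gamma>\<close> with the zero vector gives the other.\<close>

lemma nodewise_lasso_score_self:
  fixes X :: "real ^ 'p ^ 'n"
  assumes lasso: "is_nodewise_lasso X lam j \<tau> \<gamma>" and nn: "lam * \<tau> \<ge> 0"
  shows "nodewise_residual X j \<gamma> \<bullet> (X *v \<gamma>) / real CARD('n) = lam * \<tau> * l1_norm \<gamma>"
proof -
  have "\<gamma> $ j = 0"
    using lasso by (simp add: is_nodewise_lasso_def is_arg_min_def)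
  then have "nodewise_residual X j \<gamma> \<bullet> (X *v \<gamma>) / real CARD('n) \<le> lam * \<tau> * l1_norm \<gamma>"
    by (intro order_trans[OF abs_ge_self nodewise_lasso_score_bound[OF lasso nn]])
  then show ?thesis
    using nodewise_lasso_variational[OF lasso nn, of 0]
    by (simp add: matrix_vector_mult_uminus)
qed

section \<open>Stable points and uniqueness of the normalised residual\<close>

text \<open>Speaks of a single pair of scale and coefficients, so that pairs taken from different
  selections can be compared.\<close>

definition nodewise_stable_point ::
  "real ^ 'p ^ 'n \<Rightarrow> real \<Rightarrow> 'p \<Rightarrow> real \<Rightarrow> real ^ 'p \<Rightarrow> bool" where
  "nodewise_stable_point X lam j \<tau> \<gamma> \<longleftrightarrow>
     is_nodewise_lasso X lam j \<tau> \<gamma> \<and> \<tau> > 0 \<and> \<tau>\<^sup>2 = (norm_n (nodewise_residual X j \<gamma>))\<^sup>2"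

lemma sqrt_nodewise_lasso_stable_point:
  assumes "is_sqrt_nodewise_lasso X lam \<gamma>h \<tau>h"
  shows "nodewise_stable_point X lam j (\<tau>h j) (\<gamma>h j (\<tau>h j))"
  using assms by (simp add: is_sqrt_nodewise_lasso_def nodewise_stable_point_def)

definition normalized_residual :: "real ^ 'p ^ 'n \<Rightarrow> 'p \<Rightarrow> real \<Rightarrow> real ^ 'p \<Rightarrow> real ^ 'n" where
  "normalized_residual X j \<tau> \<gamma> = (1 / \<tau>) *\<^sub>R nodewise_residual X j \<gamma>"

context
  fixes X :: "real ^ 'p ^ 'n" and lam :: real
  assumes lam: "lam > 0"
begin

lemma normalized_residual_sq:
  assumes "nodewise_stable_point X lam j \<tau> \<gamma>"
  shows "normalized_residual X j \<tau> \<gamma> \<bullet> normalized_residual X j \<tau> \<gamma> = real CARD('n)"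
proof -
  define r where "r = nodewise_residual X j \<gamma>"
  have "\<tau> > 0" "r \<bullet> r = \<tau>\<^sup>2 * real CARD('n)"
    using assms by (auto simp: nodewise_stable_point_def norm_n_sq r_def)
  then show ?thesis
    by (simp add: normalized_residual_def power2_eq_square flip: r_def)
qed

text \<open>Dividing by \<open>\<tau>\<close> cancels the scale in the penalty level. The bound is
  thus the same for every stable point, which makes different stable points comparable.\<close>

lemma normalized_residual_score_bound:
  assumes "nodewise_stable_point X lam j \<tau> \<gamma>" and "\<delta> $ j = 0"
  shows "\<bar>normalized_residual X j \<tau> \<gamma> \<bullet> (X *v \<delta>) / real CARD('n)\<bar> \<le> lam * l1_norm \<delta>"
proof -
  have \<tau>: "\<tau> > 0" and lasso: "is_nodewise_lasso X lam j \<tau> \<gamma>"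
    using assms(1) by (auto simp: nodewise_stable_point_def)
  have "\<bar>nodewise_residual X j \<gamma> \<bullet> (X *v \<delta>) / real CARD('n)\<bar> \<le> lam * \<tau> * l1_norm \<delta>"
    using \<tau> lam assms(2) by (intro nodewise_lasso_score_bound[OF lasso]) auto
  then show ?thesis
    using \<tau> by (simp add: normalized_residual_def abs_mult field_simps)
qed

text \<open>Column j is the residual plus \<open>X *v \<gamma>\<close>. Stability turns the squared
  residual into the square of \<open>\<tau>\<close>, and complementary slackness evaluates the other
  part. The value is the squared tilde scale divided by \<open>\<tau>\<close>.\<close>

lemma normalized_residual_score_column:
  assumes "nodewise_stable_point X lam j \<tau> \<gamma>"
  shows "normalized_residual X j \<tau> \<gamma> \<bullet> column j X / real CARD('n) = \<tau> + lam * l1_norm \<gamma>"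
proof -
  define r where "r = nodewise_residual X j \<gamma>"
  have \<tau>: "\<tau> > 0" and lasso: "is_nodewise_lasso X lam j \<tau> \<gamma>"
    and sq: "r \<bullet> r / real CARD('n) = \<tau>\<^sup>2"
    using assms by (auto simp: nodewise_stable_point_def norm_n_sq r_def)
  have "\<gamma> $ j = 0"
    using lasso by (simp add: is_nodewise_lasso_def is_arg_min_def)
  then have "column j X = r + X *v \<gamma>"
    by (simp add: r_def nodewise_residual_eq)
  moreover have "r \<bullet> (X *v \<gamma>) / real CARD('n) = lam * \<tau> * l1_norm \<gamma>"
    unfolding r_def using \<tau> lam by (intro nodewise_lasso_score_self[OF lasso]) auto
  ultimately have "r \<bullet> column j X / real CARD('n) = \<tau> * (\<tau> + lam * l1_norm \<gamma>)"
    using sq by (simp add: inner_add_right add_divide_distrib power2_eq_square algebra_simps)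
  then show ?thesis
    using \<tau> by (simp add: normalized_residual_def field_simps flip: r_def)
qed

text \<open>The first residual is written as column j minus \<open>X *v \<gamma>1\<close>. Against
  the second normalised residual, the column has a known score and the fitted part is controlled by
  dual feasibility.\<close>

lemma normalized_residual_cross:
  assumes 1: "nodewise_stable_point X lam j \<tau>1 \<gamma>1" and 2: "nodewise_stable_point X lam j \<tau>2 \<gamma>2"
  shows "\<tau>2 + lam * l1_norm \<gamma>2 - lam * l1_norm \<gamma>1
    \<le> \<tau>1 * (normalized_residual X j \<tau>1 \<gamma>1 \<bullet> normalized_residual X j \<tau>2 \<gamma>2 / real CARD('n))"
proof -
  let ?v = "normalized_residual X j \<tau>2 \<gamma>2"
  have \<gamma>1: "\<gamma>1 $ j = 0" and \<tau>1: "\<tau>1 > 0"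
    using 1 by (auto simp: nodewise_stable_point_def is_nodewise_lasso_def is_arg_min_def)
  have "\<tau>1 * (normalized_residual X j \<tau>1 \<gamma>1 \<bullet> ?v / real CARD('n))
      = ?v \<bullet> (column j X - X *v \<gamma>1) / real CARD('n)"
    using \<tau>1 nodewise_residual_eq[OF \<gamma>1, of X]
    by (simp add: normalized_residual_def[of X j \<tau>1] inner_commute)
  also have "\<dots> = \<tau>2 + lam * l1_norm \<gamma>2 - ?v \<bullet> (X *v \<gamma>1) / real CARD('n)"
    using normalized_residual_score_column[OF 2] by (simp add: inner_diff_right diff_divide_distrib)
  finally show ?thesis
    using normalized_residual_score_bound[OF 2 \<gamma>1] by linarith
qed

lemma normalized_residual_unique:
  assumes 1: "nodewise_stable_point X lam j \<tau>1 \<gamma>1" and 2: "nodewise_stable_point X lam j \<tau>2 \<gamma>2"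
  shows "normalized_residual X j \<tau>1 \<gamma>1 = normalized_residual X j \<tau>2 \<gamma>2"
proof -
  let ?v1 = "normalized_residual X j \<tau>1 \<gamma>1" and ?v2 = "normalized_residual X j \<tau>2 \<gamma>2"
  define c where "c = ?v1 \<bullet> ?v2 / real CARD('n)"
  have \<tau>: "\<tau>1 > 0" "\<tau>2 > 0"
    using 1 2 by (auto simp: nodewise_stable_point_def)
  have "\<tau>2 + lam * l1_norm \<gamma>2 - lam * l1_norm \<gamma>1 \<le> \<tau>1 * c"
    "\<tau>1 + lam * l1_norm \<gamma>1 - lam * l1_norm \<gamma>2 \<le> \<tau>2 * c"
    using normalized_residual_cross[OF 1 2] normalized_residual_cross[OF 2 1]
    by (simp_all add: c_def inner_commute)
  \<comment> \<open>Adding the two cross inequalities cancels the l1 norms.\<close>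
  then have "(\<tau>1 + \<tau>2) * 1 \<le> (\<tau>1 + \<tau>2) * c"
    by (simp add: algebra_simps)
  then have "1 \<le> c"
    using \<tau> by (subst (asm) mult_le_cancel_left_pos) auto
  then have "?v1 \<bullet> ?v2 \<ge> real CARD('n)"
    by (simp add: c_def field_simps)
  \<comment> \<open>Both vectors have squared length n, so their squared distance is 2n minus twice
    their inner product.\<close>
  then have "(?v1 - ?v2) \<bullet> (?v1 - ?v2) \<le> 0"
    using normalized_residual_sq[OF 1] normalized_residual_sq[OF 2]
    by (simp add: inner_diff_left inner_diff_right inner_commute)
  then show ?thesis
    by (metis inner_ge_zero inner_eq_zero_iff antisym eq_iff_diff_eq_0)
qed

section \<open>Decomposition of the de-sparsified Lasso\<close>

text \<open>Column j of the surrogate inverse is a multiple of the coefficient vector that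
  \<open>X\<close> maps to the node-wise residual. The prefactor replaces its normalisation, the
  squared tilde scale, by the scale \<open>\<tau>h j\<close>.\<close>

lemma desparsified_component:
  assumes "is_sqrt_nodewise_lasso X lam \<gamma>h \<tau>h"
  shows "tilde_tau_sq lam \<gamma>h \<tau>h j / \<tau>h j * (desparsified X Y (Theta_hat lam \<gamma>h \<tau>h) b $ j - b $ j)
    = normalized_residual X j (\<tau>h j) (\<gamma>h j (\<tau>h j)) \<bullet> (Y - X *v b) / real CARD('n)"
proof -
  define \<gamma> where "\<gamma> = \<gamma>h j (\<tau>h j)"
  define T where "T = tilde_tau_sq lam \<gamma>h \<tau>h j"
  define y where "y = Y - X *v b"
  have st: "nodewise_stable_point X lam j (\<tau>h j) \<gamma>"
    unfolding \<gamma>_def using assms by (rule sqrt_nodewise_lasso_stable_point)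
  then have \<tau>: "\<tau>h j > 0" and \<gamma>: "\<gamma> $ j = 0"
    by (auto simp: nodewise_stable_point_def is_nodewise_lasso_def is_arg_min_def)
  have "l1_norm \<gamma> \<ge> 0"
    by (simp add: l1_norm_def sum_nonneg)
  then have T: "T > 0"
    using \<tau> lam by (simp add: T_def tilde_tau_sq_def add_pos_nonneg flip: \<gamma>_def)
  \<comment> \<open>Since \<open>\<gamma> $ j = 0\<close>, the diagonal and off-diagonal cases merge
    into one formula.\<close>
  have "row j (transpose (Theta_hat lam \<gamma>h \<tau>h)) = (1 / T) *\<^sub>R (axis j 1 - \<gamma>)"
    using \<gamma> by (auto simp: row_def transpose_def Theta_hat_def vec_eq_iff axis_def
        simp flip: T_def \<gamma>_def)
  then have "(transpose (Theta_hat lam \<gamma>h \<tau>h) *v (transpose X *v y)) $ j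
      = ((axis j 1 - \<gamma>) \<bullet> (transpose X *v y)) / T"
    unfolding matrix_vector_mul_component by (simp add: row_def)
  also have "(axis j 1 - \<gamma>) \<bullet> (transpose X *v y) = (X *v (axis j 1 - \<gamma>)) \<bullet> y"
    by (metis dot_lmul_matrix inner_commute vector_transpose_matrix transpose_transpose)
  also have "X *v (axis j 1 - \<gamma>) = nodewise_residual X j \<gamma>"
    by (simp add: nodewise_residual_eq[OF \<gamma>] matrix_vector_mult_diff_distrib
        matrix_vector_mul_component matrix_vector_mult_basis)
  finally show ?thesis
    using T \<tau> by (simp add: desparsified_def normalized_residual_def flip: T_def \<gamma>_def y_def)
qed

text \<open>The j-th coordinate of \<open>b - \<beta>0\<close> enters the bias with exactly the
  prefactor of the estimator, so it turns the centring at \<open>b $ j\<close> into centring at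
  \<open>\<beta>0 $ j\<close>. Dual feasibility bounds what the other coordinates
  contribute.\<close>

lemma desparsified_decomposition:
  assumes "is_sqrt_nodewise_lasso X lam \<gamma>h \<tau>h"
  shows "\<bar>tilde_tau_sq lam \<gamma>h \<tau>h j / \<tau>h j *
             (desparsified X (X *v \<beta>0 + \<epsilon>) (Theta_hat lam \<gamma>h \<tau>h) b $ j - \<beta>0 $ j)
           - normalized_residual X j (\<tau>h j) (\<gamma>h j (\<tau>h j)) \<bullet> \<epsilon> / real CARD('n)\<bar>
         \<le> lam * l1_norm (b - \<beta>0)"
proof -
  define \<gamma> where "\<gamma> = \<gamma>h j (\<tau>h j)"
  define v where "v = normalized_residual X j (\<tau>h j) \<gamma>"
  define k where "k = tilde_tau_sq lam \<gamma>h \<tau>h j / \<tau>h j"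
  define d where "d = b - \<beta>0"
  \<comment> \<open>Deleting the j-th coordinate makes the vector admissible in the score bound and
    does not increase its l1 norm.\<close>
  define \<delta> where "\<delta> = d - (d $ j) *\<^sub>R axis j 1"
  have st: "nodewise_stable_point X lam j (\<tau>h j) \<gamma>"
    unfolding \<gamma>_def using assms by (rule sqrt_nodewise_lasso_stable_point)
  then have \<tau>: "\<tau>h j > 0"
    by (simp add: nodewise_stable_point_def)
  have "k = \<tau>h j + lam * l1_norm \<gamma>"
    using \<tau> by (simp add: k_def tilde_tau_sq_def power2_eq_square field_simps flip: \<gamma>_def)
  then have k: "v \<bullet> column j X / real CARD('n) = k"
    using normalized_residual_score_column[OF st] by (simp add: v_def)
  have "X *v d = X *v \<delta> + (d $ j) *\<^sub>R column j X"
    by (simp add: \<delta>_def matrix_vector_mult_diff_distrib matrix_vector_mult_scaleR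
        matrix_vector_mult_basis)
  then have Xd: "v \<bullet> (X *v d) / real CARD('n) = v \<bullet> (X *v \<delta>) / real CARD('n) + d $ j * k"
    by (simp add: inner_add_right add_divide_distrib flip: k)
  have "X *v \<beta>0 + \<epsilon> - X *v b = \<epsilon> - X *v d"
    by (simp add: d_def matrix_vector_mult_diff_distrib)
  then have "k * (desparsified X (X *v \<beta>0 + \<epsilon>) (Theta_hat lam \<gamma>h \<tau>h) b $ j - b $ j)
      = v \<bullet> \<epsilon> / real CARD('n) - v \<bullet> (X *v d) / real CARD('n)"
    using desparsified_component[OF assms, of j "X *v \<beta>0 + \<epsilon>" b]
    unfolding k_def v_def \<gamma>_def by (simp only: inner_diff_right[of _ \<epsilon>] diff_divide_distrib)
  then have "k * (desparsified X (X *v \<beta>0 + \<epsilon>) (Theta_hat lam \<gamma>h \<tau>h) b $ j - \<beta>0 $ j)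
      - v \<bullet> \<epsilon> / real CARD('n) = - (v \<bullet> (X *v \<delta>) / real CARD('n))"
    unfolding Xd by (simp add: d_def algebra_simps)
  moreover have "\<bar>v \<bullet> (X *v \<delta>) / real CARD('n)\<bar> \<le> lam * l1_norm \<delta>"
    unfolding v_def by (rule normalized_residual_score_bound[OF st]) (simp add: \<delta>_def)
  moreover have "l1_norm \<delta> \<le> l1_norm d"
    unfolding l1_norm_def by (rule sum_mono) (simp add: \<delta>_def axis_def)
  then have "lam * l1_norm \<delta> \<le> lam * l1_norm d"
    using lam by simp
  ultimately show ?thesis
    by (simp add: k_def v_def \<gamma>_def d_def)
qed

end

section \<open>One direction for all node-wise solutions\<close>

theorem theorem2p4p1:
  fixes X :: "real ^ 'p ^ 'n" and lam_under :: real
  assumes "rank X = CARD('n)" and "lam_under > 0"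
  shows "\<exists>v :: 'p \<Rightarrow> real ^ 'n. (\<forall>j. norm_n (v j) = 1) \<and>
    (\<forall>(\<gamma>h :: 'p \<Rightarrow> real \<Rightarrow> real ^ 'p) (\<tau>h :: 'p \<Rightarrow> real)
       (\<beta>0 :: real ^ 'p) (\<epsilon> :: real ^ 'n) (Y :: real ^ 'n)
       (lam_bar :: real) (\<sigma> :: real) (\<beta>h :: real ^ 'p).
       is_sqrt_nodewise_lasso X lam_under \<gamma>h \<tau>h \<longrightarrow>
       Y = X *v \<beta>0 + \<epsilon> \<longrightarrow> \<sigma> > 0 \<longrightarrow> lam_bar > 0 \<longrightarrow>
       is_lasso X Y lam_bar \<sigma> \<beta>h \<longrightarrow>
       (\<exists>remd :: real ^ 'p.
          (\<forall>j. tilde_tau_sq lam_under \<gamma>h \<tau>h j / \<tau>h j *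
                (desparsified X Y (Theta_hat lam_under \<gamma>h \<tau>h) \<beta>h $ j - \<beta>0 $ j)
              = v j \<bullet> \<epsilon> / real CARD('n) + remd $ j) \<and>
          infnorm remd \<le> lam_under * l1_norm (\<beta>h - \<beta>0)))"
proof -
  \<comment> \<open>The vectors are fixed before the selections, scales and noise are quantified.
    Uniqueness of the normalised residual lets one choice serve every selection.\<close>
  obtain v :: "'p \<Rightarrow> real ^ 'n" where v: "\<And>j. norm_n (v j) = 1"
    "\<And>\<gamma>h \<tau>h j. is_sqrt_nodewise_lasso X lam_under \<gamma>h \<tau>h
       \<Longrightarrow> v j = normalized_residual X j (\<tau>h j) (\<gamma>h j (\<tau>h j))"
  proof (cases "\<exists>\<gamma>h \<tau>h. is_sqrt_nodewise_lasso X lam_under \<gamma>h \<tau>h")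
    case True
    then obtain \<gamma>h \<tau>h where *: "is_sqrt_nodewise_lasso X lam_under \<gamma>h \<tau>h"
      by blast
    note st = sqrt_nodewise_lasso_stable_point
    show thesis
    proof (rule that)
      show "norm_n (normalized_residual X j (\<tau>h j) (\<gamma>h j (\<tau>h j))) = 1" for j
        using normalized_residual_sq[OF assms(2) st[OF *]] by (simp add: norm_n_def)
    qed (rule normalized_residual_unique[OF assms(2) st[OF *] st])
  next
    case False
    show thesis
    proof (rule that)
      \<comment> \<open>Without any stable selection the second property is vacuous, and the
        all-ones vector supplies the norm.\<close>
      show "norm_n ((\<chi> i. 1) :: real ^ 'n) = 1"
        by (simp add: norm_n_def inner_vec_def)
    qed (use False in blast)
  qed
  show ?thesis
  proof (intro exI[of _ v] conjI allI impI, rule v(1))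
    fix \<gamma>h :: "'p \<Rightarrow> real \<Rightarrow> real ^ 'p" and \<tau>h \<beta>0 \<epsilon> Y and lam_bar \<sigma> :: real and \<beta>h
    assume *: "is_sqrt_nodewise_lasso X lam_under \<gamma>h \<tau>h" and Y: "Y = X *v \<beta>0 + \<epsilon>"
    \<comment> \<open>With the remainder defined as the difference, the decomposition holds by
      construction and only the bound is left.\<close>
    define remd :: "real ^ 'p" where "remd = (\<chi> j. tilde_tau_sq lam_under \<gamma>h \<tau>h j / \<tau>h j *
      (desparsified X Y (Theta_hat lam_under \<gamma>h \<tau>h) \<beta>h $ j - \<beta>0 $ j) - v j \<bullet> \<epsilon> / real CARD('n))"
    have "infnorm remd \<le> lam_under * l1_norm (\<beta>h - \<beta>0)"
      using desparsified_decomposition[OF assms(2) *]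
      by (simp add: infnorm_le_iff_component remd_def Y v(2)[OF *])
    then show "\<exists>remd :: real ^ 'p.
          (\<forall>j. tilde_tau_sq lam_under \<gamma>h \<tau>h j / \<tau>h j *
                (desparsified X Y (Theta_hat lam_under \<gamma>h \<tau>h) \<beta>h $ j - \<beta>0 $ j)
              = v j \<bullet> \<epsilon> / real CARD('n) + remd $ j) \<and>
          infnorm remd \<le> lam_under * l1_norm (\<beta>h - \<beta>0)"
      by (intro exI[of _ remd]) (simp add: remd_def)
  qed
qed

end
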